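(* Let $G=(V,E)$ be a strongly regular graph with parameters $(n,d,\alpha,\beta)$. Let $xy\in E$ and let $\mathcal{M}$ be a maximum matching between $N_x$ and $N_y$, of size $m$. Then the condensed Ricci curvature is $$\Bbbk(x,y)=\frac{\alpha+2}{d}-\frac{|N_x|-m}{d}.$$
   Context: A strongly regular graph with parameters $(n,d,\alpha,\beta)$ is a finite undirected simple graph with $n$ vertices, all of degree $d$, such that any two adjacent vertices have exactly $\alpha\ge 0$ common neighbors and any two distinct nonadjacent vertices have exactly $\beta\ge 1$ common neighbors. Let $\rho$ be the shortest-path distance on $G$ and $\Gamma(x)=\{z\in V: xz\in E\}$. For an edge $xy\in E$ put $\nabla_{xy}=\Gamma(x)\cap\Gamma(y)$, $N_x=\Gamma(x)\setminus(\nabla_{xy}\cup\{y\})$ and $N_y=\Gamma(y)\setminus(\nabla_{xy}\cup\{x\})$. A matching between $N_x$ and $N_y$ is a set of edges of $G$, each joining a vertex of $N_x$ to a vertex of $N_y$, such that no vertex is incident to more than one of them; its size is its number of edges, and it is a maximum matching if its size is the largest possible among such matchings. A probability measure on $G$ is a function $\mu:V\to[0,1]$ with $\sum_{v\in V}\mu(v)=1$. A transport plan between probability measures $\mu$ and $\nu$ is a function $\xi:V\times V\to[0,1]$ with $\sum_{w\in V}\xi(v,w)=\mu(v)$ for all $v\in V$ and $\sum_{v\in V}\xi(v,w)=\nu(w)$ for all $w\in V$. The transport ($L^1$-Wasserstein) distance is $W(\mu,\nu)=\inf_{\xi}\sum_{x\in V}\sum_{y\in V}\rho(x,y)\,\xi(x,y)$,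 the infimum being over all transport plans $\xi$ between $\mu$ and $\nu$. For $0\le\varepsilon\le 1$ and $x\in V$, let $m_x^{\varepsilon}$ be the probability measure with $m_x^{\varepsilon}(x)=1-\varepsilon$, $m_x^{\varepsilon}(y)=\frac{\varepsilon}{|\Gamma(x)|}$ for $y\in\Gamma(x)$, and $m_x^{\varepsilon}(y)=0$ otherwise. For distinct $x,y\in V$ set $\kappa_{\varepsilon}(x,y)=1-\frac{W(m_x^{\varepsilon},m_y^{\varepsilon})}{\rho(x,y)}$. The condensed Ricci curvature is $\Bbbk(x,y)=\lim_{\varepsilon\to 0^+}\frac{\kappa_{\varepsilon}(x,y)}{\varepsilon}$ (this limit is known to exist). *)

theory Defs
  imports
    "HOL-Analysis.Analysis"
    "Graph_Theory.Pair_Digraph"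
    "Graph_Theory.Shortest_Path"
begin

text \<open>
  A finite undirected simple graph is a \<^locale>\<open>pair_graph\<close>: a finite, loop-free, symmetric
  relation on a finite vertex set. An undirected edge \<open>xy\<close> is thus represented by its two arcs
  \<open>(x, y)\<close> and \<open>(y, x)\<close>.
\<close>

definition nbhd :: "'a pair_pre_digraph \<Rightarrow> 'a \<Rightarrow> 'a set" where
  "nbhd G x = {z \<in> pverts G. (x, z) \<in> parcs G}"

locale strongly_regular_graph = pair_graph G for G :: "'a pair_pre_digraph" +
  fixes n d \<alpha> \<beta> :: nat
  assumes card_verts: "card (pverts G) = n"
    and regular: "v \<in> pverts G \<Longrightarrow> card (nbhd G v) = d"
    and adjacent: "(u, v) \<in> parcs G \<Longrightarrow> card (nbhd G u \<inter> nbhd G v) = \<alpha>"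
    and nonadjacent: "\<lbrakk>u \<in> pverts G; v \<in> pverts G; u \<noteq> v; (u, v) \<notin> parcs G\<rbrakk>
      \<Longrightarrow> card (nbhd G u \<inter> nbhd G v) = \<beta>"
    and beta_pos: "\<beta> \<ge> 1"

text \<open>
  Least number of edges of a walk from \<open>u\<close> to \<open>v\<close>. The library's distance is extended real
  (infinite between different components); strongly regular graphs are connected because
  \<open>\<beta> \<ge> 1\<close>, so there the conversion to \<open>real\<close> loses nothing.
\<close>
definition graph_dist :: "'a pair_pre_digraph \<Rightarrow> 'a \<Rightarrow> 'a \<Rightarrow> real" where
  "graph_dist G u v = real_of_ereal (wf_digraph.\<mu> (with_proj G) (\<lambda>_. 1) u v)"

definition nabla :: "'a pair_pre_digraph \<Rightarrow> 'a \<Rightarrow> 'a \<Rightarrow> 'a set" where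
  "nabla G x y = nbhd G x \<inter> nbhd G y"

text \<open>For an edge \<open>xy\<close>, \<open>N_x\<close> is \<open>excl_nbhd G x y\<close> and \<open>N_y\<close> is \<open>excl_nbhd G y x\<close>.\<close>
definition excl_nbhd :: "'a pair_pre_digraph \<Rightarrow> 'a \<Rightarrow> 'a \<Rightarrow> 'a set" where
  "excl_nbhd G x y = nbhd G x - (nabla G x y \<union> {y})"

text \<open>
  Every edge of a matching is represented once, by the arc leading from \<open>A\<close> to \<open>B\<close>
  (for disjoint \<open>A\<close> and \<open>B\<close>, such as \<open>N_x\<close> and \<open>N_y\<close>, this arc is unique).
\<close>
definition matching_between ::
    "'a pair_pre_digraph \<Rightarrow> 'a set \<Rightarrow> 'a set \<Rightarrow> ('a \<times> 'a) set \<Rightarrow> bool" where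
  "matching_between G A B M \<longleftrightarrow> M \<subseteq> parcs G \<inter> (A \<times> B) \<and>
     (\<forall>e\<in>M. \<forall>f\<in>M. e \<noteq> f \<longrightarrow> {fst e, snd e} \<inter> {fst f, snd f} = {})"

definition maximum_matching_between ::
    "'a pair_pre_digraph \<Rightarrow> 'a set \<Rightarrow> 'a set \<Rightarrow> ('a \<times> 'a) set \<Rightarrow> bool" where
  "maximum_matching_between G A B M \<longleftrightarrow> matching_between G A B M \<and>
     (\<forall>M'. matching_between G A B M' \<longrightarrow> card M' \<le> card M)"

definition prob_measure_on :: "'a set \<Rightarrow> ('a \<Rightarrow> real) \<Rightarrow> bool" where
  "prob_measure_on V p \<longleftrightarrow> (\<forall>v\<in>V. 0 \<le> p v \<and> p v \<le> 1) \<and> (\<Sum>v\<in>V. p v) = 1"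

definition transport_plan ::
    "'a set \<Rightarrow> ('a \<Rightarrow> real) \<Rightarrow> ('a \<Rightarrow> real) \<Rightarrow> ('a \<times> 'a \<Rightarrow> real) \<Rightarrow> bool" where
  "transport_plan V p q \<xi> \<longleftrightarrow> (\<forall>v\<in>V. \<forall>w\<in>V. 0 \<le> \<xi> (v, w) \<and> \<xi> (v, w) \<le> 1) \<and>
     (\<forall>v\<in>V. (\<Sum>w\<in>V. \<xi> (v, w)) = p v) \<and>
     (\<forall>w\<in>V. (\<Sum>v\<in>V. \<xi> (v, w)) = q w)"

definition wasserstein :: "'a pair_pre_digraph \<Rightarrow> ('a \<Rightarrow> real) \<Rightarrow> ('a \<Rightarrow> real) \<Rightarrow> real" where
  "wasserstein G p q =
     (INF \<xi>\<in>{\<xi>. transport_plan (pverts G) p q \<xi>}.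
        \<Sum>v\<in>pverts G. \<Sum>w\<in>pverts G. graph_dist G v w * \<xi> (v, w))"

definition lazy_measure :: "'a pair_pre_digraph \<Rightarrow> real \<Rightarrow> 'a \<Rightarrow> 'a \<Rightarrow> real" where
  "lazy_measure G \<epsilon> x y =
     (if y = x then 1 - \<epsilon> else if y \<in> nbhd G x then \<epsilon> / real (card (nbhd G x)) else 0)"

lemma (in pair_graph) prob_measure_on_lazy_measure:
  assumes "x \<in> pverts G" "nbhd G x \<noteq> {}" "0 \<le> \<epsilon>" "\<epsilon> \<le> 1"
  shows "prob_measure_on (pverts G) (lazy_measure G \<epsilon> x)"
proof -
  let ?N = "nbhd G x" and ?V = "pverts G"
  have sub: "?N \<subseteq> ?V" and xN: "x \<notin> ?N"
    using pair_no_loops[of "(x, x)"] by (auto simp: nbhd_def)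
  have fin: "finite ?V" and finN: "finite ?N"
    using pair_finite_verts finite_subset[OF sub] by auto
  have c: "card ?N \<ge> 1"
    using finN assms(2) by (simp add: Suc_le_eq card_gt_0_iff)
  have "(\<Sum>v\<in>?V. lazy_measure G \<epsilon> x v) = (\<Sum>v\<in>insert x ?N. lazy_measure G \<epsilon> x v)"
    using fin sub assms(1) by (intro sum.mono_neutral_right) (auto simp: lazy_measure_def)
  also have "\<dots> = (1 - \<epsilon>) + (\<Sum>v\<in>?N. lazy_measure G \<epsilon> x v)"
    using finN xN by (simp add: lazy_measure_def)
  also have "(\<Sum>v\<in>?N. lazy_measure G \<epsilon> x v) = (\<Sum>v\<in>?N. \<epsilon> / real (card ?N))"
    using xN by (intro sum.cong) (auto simp: lazy_measure_def)
  also have "(1 - \<epsilon>) + \<dots> = 1"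
    using c by simp
  finally have "(\<Sum>v\<in>?V. lazy_measure G \<epsilon> x v) = 1" .
  moreover have "\<epsilon> / real (card ?N) \<le> 1"
    using c assms by (simp add: divide_le_eq)
  ultimately show ?thesis
    using assms by (auto simp: prob_measure_on_def lazy_measure_def)
qed

definition ollivier_curvature :: "'a pair_pre_digraph \<Rightarrow> real \<Rightarrow> 'a \<Rightarrow> 'a \<Rightarrow> real" where
  "ollivier_curvature G \<epsilon> x y =
     1 - wasserstein G (lazy_measure G \<epsilon> x) (lazy_measure G \<epsilon> y) / graph_dist G x y"

definition condensed_ricci_curvature :: "'a pair_pre_digraph \<Rightarrow> 'a \<Rightarrow> 'a \<Rightarrow> real" where
  "condensed_ricci_curvature G x y = Lim (at_right 0) (\<lambda>\<epsilon>. ollivier_curvature G \<epsilon> x y / \<epsilon>)"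

end

theory Submission
  imports Defs
begin

text \<open>
  An optimal plan moves the mass \<open>1 - \<epsilon> - \<epsilon>/d\<close> from \<open>x\<close> to \<open>y\<close>, fixes \<open>\<epsilon>/d\<close> at \<open>x\<close>, at \<open>y\<close> and at
  each common neighbour, and sends \<open>N_x\<close> to \<open>N_y\<close> along a bijection extending a maximum matching;
  as \<open>\<beta> \<ge> 1\<close>, the unmatched vertices travel distance two. Optimality follows from
  Kantorovich duality together with Koenig's theorem: for a vertex cover of size \<open>m\<close> of the
  bipartite graph between \<open>N_x\<close> and \<open>N_y\<close>, the function equal to 2 on the uncovered part of \<open>N_x\<close>,
  to 0 at \<open>y\<close> and on the uncovered part of \<open>N_y\<close>, and to 1 elsewhere is 1-Lipschitz.
\<close>

section \<open>Koenig's theorem\<close>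

text \<open>Finiteness is demanded because \<open>card\<close> of an infinite set is 0, so infinite
  covers would count as free.\<close>

definition bipartite_cover :: "('a \<times> 'b) set \<Rightarrow> 'a set \<Rightarrow> 'b set \<Rightarrow> bool" where
  "bipartite_cover E P Q \<longleftrightarrow> finite P \<and> finite Q \<and> (\<forall>(a, b)\<in>E. a \<in> P \<or> b \<in> Q)"

lemma bipartite_cover_converse: "bipartite_cover (E\<inverse>) Q P \<longleftrightarrow> bipartite_cover E P Q"
  by (auto simp: bipartite_cover_def)

text \<open>
  Uncrossing: small covers of \<open>E\<close> without \<open>(a, b)\<close> and of \<open>E\<close> without \<open>(a, b')\<close> recombine, by
  intersecting on one side and uniting on the other, into two covers of \<open>E\<close>, once \<open>a\<close> is added to one
  of them; this costs only one vertex in total, while each small cover saved one.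
\<close>
lemma critical_no_fork:
  assumes lower: "\<And>P Q. bipartite_cover E P Q \<Longrightarrow> t \<le> card P + card Q"
    and critical: "\<And>e. e \<in> E \<Longrightarrow> \<exists>P Q. bipartite_cover (E - {e}) P Q \<and> card P + card Q < t"
    and E: "(a, b) \<in> E" "(a, b') \<in> E"
  shows "b = b'"
proof (rule ccontr)
  assume ne: "b \<noteq> b'"
  obtain P Q where PQ: "bipartite_cover (E - {(a, b)}) P Q" "card P + card Q < t"
    using critical[OF E(1)] by blast
  obtain P' Q' where PQ': "bipartite_cover (E - {(a, b')}) P' Q'" "card P' + card Q' < t"
    using critical[OF E(2)] by blast
  have fin: "finite P" "finite Q" "finite P'" "finite Q'"
    using PQ PQ' by (auto simp: bipartite_cover_def)
  have "\<not> bipartite_cover E P Q" "\<not> bipartite_cover E P' Q'"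
    using lower PQ(2) PQ'(2) by (meson not_le)+
  \<comment> \<open>A cover of all edges but one that fails to cover \<open>E\<close> misses both
    ends of the removed edge, in particular \<open>a\<close>. Each removed edge survives in the
    other reduced set, where only its right end can cover it.\<close>
  then have a: "a \<notin> P" "a \<notin> P'"
    using PQ(1) PQ'(1) by (auto simp: bipartite_cover_def)
  have "b \<in> Q'" "b' \<in> Q"
    using PQ(1) PQ'(1) E ne a by (auto simp: bipartite_cover_def)
  then have "bipartite_cover E (P \<inter> P') (Q \<union> Q')"
    using PQ(1) PQ'(1) by (fastforce simp: bipartite_cover_def)
  then have 1: "t \<le> card (P \<inter> P') + card (Q \<union> Q')"
    by (rule lower)
  have "bipartite_cover E (insert a (P \<union> P')) (Q \<inter> Q')"
    using PQ(1) PQ'(1) by (fastforce simp: bipartite_cover_def)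
  then have "t \<le> card (insert a (P \<union> P')) + card (Q \<inter> Q')"
    by (rule lower)
  then have 2: "t \<le> Suc (card (P \<union> P')) + card (Q \<inter> Q')"
    using fin a by simp
  show False
    using 1 2 PQ(2) PQ'(2) card_Un_Int[OF fin(1,3)] card_Un_Int[OF fin(2,4)] by linarith
qed

text \<open>
  A set of edges that is minimal among those needing covers as large as \<open>E\<close> does is a matching.
\<close>
theorem koenig:
  assumes fin: "finite E"
  obtains M P Q where "M \<subseteq> E" "inj_on fst M" "inj_on snd M"
    "bipartite_cover E P Q" "card P + card Q \<le> card M"
proof -
  have "bipartite_cover E (fst ` E) {}"
    using fin by (force simp: bipartite_cover_def)
  then have ex: "\<exists>t P Q. bipartite_cover E P Q \<and> card P + card Q = t"
    by blast
  define t where "t = (LEAST t. \<exists>P Q. bipartite_cover E P Q \<and> card P + card Q = t)"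
  have t: "\<exists>P Q. bipartite_cover E P Q \<and> card P + card Q = t"
    unfolding t_def by (rule LeastI_ex[OF ex])
  have t_least: "t \<le> card P + card Q" if "bipartite_cover E P Q" for P Q
    unfolding t_def by (rule Least_le) (use that in blast)
  define needs where
    "needs M \<longleftrightarrow> M \<subseteq> E \<and> (\<forall>P Q. bipartite_cover M P Q \<longrightarrow> t \<le> card P + card Q)" for M
  have "needs E"
    using t_least by (auto simp: needs_def)
  then obtain M where M: "needs M" and M_least: "\<And>M'. needs M' \<Longrightarrow> card M \<le> card M'"
    using ex_has_least_nat[of needs E card] by blast
  have ME: "M \<subseteq> E" and lower: "\<And>P Q. bipartite_cover M P Q \<Longrightarrow> t \<le> card P + card Q"
    using M by (auto simp: needs_def)
  have finM: "finite M"
    using ME fin finite_subset by blast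
  have critical: "\<exists>P Q. bipartite_cover (M - {e}) P Q \<and> card P + card Q < t" if "e \<in> M" for e
  proof -
    have "card (M - {e}) < card M"
      using that finM by (meson card_Diff1_less)
    then have "\<not> needs (M - {e})"
      using M_least by (meson not_le)
    then show ?thesis
      using ME by (auto simp: needs_def not_le)
  qed
  have "inj_on fst M"
    using critical_no_fork[of M t, OF lower critical] by (auto intro!: inj_onI)
  moreover have "inj_on snd M"
  proof -
    \<comment> \<open>The fork lemma treats edges with a common left end; reversing all edges and
      swapping the two sides of each cover gives the case of a common right end.\<close>
    have "a = a'" if "(a, b) \<in> M" "(a', b) \<in> M" for a a' b
    proof (rule critical_no_fork[of "M\<inverse>" t b a a'])
      show "t \<le> card P + card Q" if "bipartite_cover (M\<inverse>) P Q" for P Q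
        using lower[of Q P] that by (simp add: bipartite_cover_converse)
      show "\<exists>P Q. bipartite_cover (M\<inverse> - {e}) P Q \<and> card P + card Q < t" if "e \<in> M\<inverse>" for e
      proof -
        obtain u v where e: "e = (u, v)"
          by (cases e)
        have "M\<inverse> - {e} = (M - {(v, u)})\<inverse>"
          using e by auto
        moreover have "(v, u) \<in> M"
          using that e by simp
        then obtain P Q where "bipartite_cover (M - {(v, u)}) P Q" "card P + card Q < t"
          using critical by blast
        ultimately show ?thesis
          by (metis add.commute bipartite_cover_converse)
      qed
    qed (use that in auto)
    then show ?thesis
      by (auto intro!: inj_onI)
  qed
  moreover have "t \<le> card M"
  proof -
    \<comment> \<open>The left ends of \<open>M\<close> already cover \<open>M\<close>, so there are
      at least \<open>t\<close> of them.\<close>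
    have "bipartite_cover M (fst ` M) {}"
      using finM by (force simp: bipartite_cover_def)
    from lower[OF this] show ?thesis
      using card_image_le[OF finM, of fst] by simp
  qed
  ultimately show ?thesis
    using that t ME by metis
qed

text \<open>The vertices left unmatched on the two sides are equally many, so any bijection between
  them completes the partner map of \<open>M\<close>. Applied to \<open>N_x\<close> and
  \<open>N_y\<close>, this yields the transport map.\<close>

lemma matching_extends_to_bij:
  assumes fin: "finite A" "finite B" and card: "card A = card B"
    and M: "M \<subseteq> A \<times> B" "inj_on fst M" "inj_on snd M"
  obtains \<sigma> where "bij_betw \<sigma> A B" "\<And>a b. (a, b) \<in> M \<Longrightarrow> \<sigma> a = b"
proof -
  have sub: "fst ` M \<subseteq> A" "snd ` M \<subseteq> B"
    using M(1) by auto
  have finM: "finite M"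
    using M(1) fin finite_subset by blast
  have "card (A - fst ` M) = card (B - snd ` M)"
    using sub fin card M(2,3) finM by (simp add: card_Diff_subset card_image)
  then obtain h where h: "bij_betw h (A - fst ` M) (B - snd ` M)"
    using fin by (meson finite_Diff finite_same_card_bij)
  define g where "g = snd \<circ> inv_into M fst"
  have g_eq: "g a = b" if "(a, b) \<in> M" for a b
    using inv_into_f_f[OF M(2) that] by (simp add: g_def)
  have g: "bij_betw g (fst ` M) (snd ` M)"
    unfolding g_def using M(2,3)
    by (intro bij_betw_trans[where B = M] bij_betw_inv_into) (auto simp: bij_betw_def)
  define \<sigma> where "\<sigma> a = (if a \<in> fst ` M then g a else h a)" for a
  have "bij_betw \<sigma> (fst ` M \<union> (A - fst ` M)) (snd ` M \<union> (B - snd ` M))"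
    unfolding \<sigma>_def using g h by (intro bij_betw_disjoint_Un) auto
  then have "bij_betw \<sigma> A B"
    using sub by (simp add: Un_absorb1)
  moreover have "\<sigma> a = b" if "(a, b) \<in> M" for a b
    using that g_eq[OF that] by (force simp: \<sigma>_def)
  ultimately show ?thesis
    using that by blast
qed

section \<open>Graph distance\<close>

context pair_wf_digraph
begin

lemma awalk_cost_unit: "awalk_cost (\<lambda>_. 1) p = real (length p)"
  by (induction p) auto

text \<open>With unit costs the infimum over walks is attained at a shortest walk, so exhibiting one
  settles the distance.\<close>

lemma graph_dist_eqI:
  assumes "awalk u p v" "\<And>q. awalk u q v \<Longrightarrow> length p \<le> length q"
  shows "graph_dist G u v = real (length p)"
proof -
  have "\<mu> (\<lambda>_. 1) u v = ereal (real (length p))"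
    unfolding \<mu>_def awalk_cost_unit using assms by (intro INF_eqI) auto
  then show ?thesis
    by (simp add: graph_dist_def)
qed

lemma graph_dist_refl: "u \<in> pverts G \<Longrightarrow> graph_dist G u u = 0"
  using graph_dist_eqI[of u "[]" u] by (simp add: awalk_Nil_iff)

end

context pair_loopfree_digraph
begin

lemma graph_dist_adjacent:
  assumes "(u, v) \<in> parcs G"
  shows "graph_dist G u v = 1"
proof -
  have ne: "u \<noteq> v"
    using assms pair_no_loops[of "(u, u)"] by auto
  have "graph_dist G u v = real (length [(u, v)])"
  proof (rule graph_dist_eqI)
    show "awalk u [(u, v)] v"
      using assms arc_snd_in_verts[OF assms] by (auto simp: awalk_simps)
    show "length [(u, v)] \<le> length q" if "awalk u q v" for q
      using that ne by (cases q) (auto simp: awalk_simps)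
  qed
  then show ?thesis
    by simp
qed

lemma graph_dist_two:
  assumes arcs: "(u, w) \<in> parcs G" "(w, v) \<in> parcs G" and "u \<noteq> v" "(u, v) \<notin> parcs G"
  shows "graph_dist G u v = 2"
proof -
  have "graph_dist G u v = real (length [(u, w), (w, v)])"
  proof (rule graph_dist_eqI)
    show "awalk u [(u, w), (w, v)] v"
      using arcs arc_snd_in_verts[OF arcs(2)] by (auto simp: awalk_simps)
    show "length [(u, w), (w, v)] \<le> length q" if "awalk u q v" for q
    proof -
      have "q \<noteq> []"
        using that assms(3) by (auto simp: awalk_Nil_iff)
      moreover have "q \<noteq> [e]" for e
        using that assms(4) by (cases e) (auto simp: awalk_simps)
      ultimately have "\<not> length q < 2"
        by (auto simp: less_2_cases_iff length_Suc_conv)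
      then show ?thesis
        by simp
    qed
  qed
  then show ?thesis
    by simp
qed

end

lemma (in pair_graph) nbhd_sym: "v \<in> nbhd G u \<longleftrightarrow> (u, v) \<in> parcs G"
  using arc_snd_in_verts[of "(u, v)"] by (auto simp: nbhd_def)

lemma (in pair_graph) parcs_sym: "(u, v) \<in> parcs G \<longleftrightarrow> (v, u) \<in> parcs G"
  using pair_sym_arcs by (auto simp: symmetric_def dest: symD)

text \<open>Since \<beta> is positive, distinct nonadjacent vertices have a common neighbour, so no
  distance exceeds two.\<close>

lemma (in strongly_regular_graph) graph_dist_eq:
  assumes "u \<in> pverts G" "v \<in> pverts G"
  shows "graph_dist G u v = (if u = v then 0 else if (u, v) \<in> parcs G then 1 else 2)"
proof -
  have "graph_dist G u v = 2" if "u \<noteq> v" "(u, v) \<notin> parcs G"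
  proof -
    have "card (nbhd G u \<inter> nbhd G v) \<noteq> 0"
      using nonadjacent[OF assms that] beta_pos by simp
    then obtain w where "w \<in> nbhd G u" "w \<in> nbhd G v"
      by (metis card.empty disjoint_iff)
    then show ?thesis
      using that graph_dist_two[of u w v] by (simp add: nbhd_sym parcs_sym)
  qed
  then show ?thesis
    using assms by (simp add: graph_dist_refl graph_dist_adjacent)
qed

section \<open>Optimal transport\<close>

text \<open>Weak Kantorovich duality: a plan bounds the distance from above and a 1-Lipschitz
  potential bounds it from below. When the two bounds meet at \<open>c\<close>, they certify the
  value without strong duality.\<close>

lemma wasserstein_eqI:
  assumes nonneg: "\<And>u v. u \<in> pverts G \<Longrightarrow> v \<in> pverts G \<Longrightarrow> 0 \<le> graph_dist G u v"
    and plan: "transport_plan (pverts G) p q \<xi>"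
    and cost: "(\<Sum>v\<in>pverts G. \<Sum>w\<in>pverts G. graph_dist G v w * \<xi> (v, w)) \<le> c"
    and Lipschitz: "\<And>u v. u \<in> pverts G \<Longrightarrow> v \<in> pverts G \<Longrightarrow> f u - f v \<le> graph_dist G u v"
    and dual: "c \<le> (\<Sum>v\<in>pverts G. f v * p v) - (\<Sum>v\<in>pverts G. f v * q v)"
  shows "wasserstein G p q = c"
proof (rule antisym)
  let ?V = "pverts G"
  let ?cost = "\<lambda>\<xi>. \<Sum>v\<in>?V. \<Sum>w\<in>?V. graph_dist G v w * \<xi> (v, w)"
  have "bdd_below (?cost ` {\<xi>. transport_plan ?V p q \<xi>})"
    by (rule bdd_belowI[where m = 0])
      (auto intro!: sum_nonneg mult_nonneg_nonneg nonneg simp: transport_plan_def)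
  then have "wasserstein G p q \<le> ?cost \<xi>"
    unfolding wasserstein_def using plan by (intro cINF_lower) auto
  then show "wasserstein G p q \<le> c"
    using cost by simp
  have "c \<le> ?cost \<eta>" if \<eta>: "transport_plan ?V p q \<eta>" for \<eta>
  proof -
    \<comment> \<open>Both integrals become double sums against the same plan \<open>\<eta>\<close>,
      by its row and column marginals; their difference then compares termwise with the
      cost.\<close>
    have "(\<Sum>v\<in>?V. f v * p v) = (\<Sum>v\<in>?V. \<Sum>w\<in>?V. f v * \<eta> (v, w))"
      using \<eta> by (intro sum.cong) (auto simp: transport_plan_def simp flip: sum_distrib_left)
    moreover have "(\<Sum>w\<in>?V. f w * q w) = (\<Sum>w\<in>?V. \<Sum>v\<in>?V. f w * \<eta> (v, w))"
      using \<eta> by (intro sum.cong) (auto simp: transport_plan_def simp flip: sum_distrib_left)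
    moreover have "\<dots> = (\<Sum>v\<in>?V. \<Sum>w\<in>?V. f w * \<eta> (v, w))"
      by (rule sum.swap)
    moreover have "(\<Sum>v\<in>?V. \<Sum>w\<in>?V. f v * \<eta> (v, w)) - (\<Sum>v\<in>?V. \<Sum>w\<in>?V. f w * \<eta> (v, w))
        = (\<Sum>v\<in>?V. \<Sum>w\<in>?V. (f v - f w) * \<eta> (v, w))"
      by (simp add: sum_subtractf left_diff_distrib)
    moreover have "\<dots> \<le> ?cost \<eta>"
      using \<eta> Lipschitz by (intro sum_mono mult_right_mono) (auto simp: transport_plan_def)
    ultimately show ?thesis
      using dual by linarith
  qed
  then show "c \<le> wasserstein G p q"
    unfolding wasserstein_def using plan by (intro cINF_greatest) auto
qed

text \<open>Nonnegative entries are at most their row sum, which is a value of a probability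
  measure; the upper bound 1 thus needs no separate check.\<close>

lemma transport_planI:
  assumes fin: "finite V" and p: "prob_measure_on V p"
    and nonneg: "\<And>v w. v \<in> V \<Longrightarrow> w \<in> V \<Longrightarrow> 0 \<le> \<xi> (v, w)"
    and rows: "\<And>v. v \<in> V \<Longrightarrow> (\<Sum>w\<in>V. \<xi> (v, w)) = p v"
    and columns: "\<And>w. w \<in> V \<Longrightarrow> (\<Sum>v\<in>V. \<xi> (v, w)) = q w"
  shows "transport_plan V p q \<xi>"
proof -
  have "\<xi> (v, w) \<le> 1" if "v \<in> V" "w \<in> V" for v w
  proof -
    have "\<xi> (v, w) \<le> (\<Sum>w\<in>V. \<xi> (v, w))"
      using that nonneg fin by (intro member_le_sum) auto
    also have "\<dots> \<le> 1"
      using rows p that by (simp add: prob_measure_on_def)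
    finally show ?thesis .
  qed
  then show ?thesis
    using nonneg rows columns by (simp add: transport_plan_def)
qed

context strongly_regular_graph
begin

lemma sum_lazy_measure:
  assumes x: "x \<in> pverts G"
  shows "(\<Sum>v\<in>pverts G. f v * lazy_measure G \<epsilon> x v)
    = (1 - \<epsilon>) * f x + \<epsilon> / real d * (\<Sum>v\<in>nbhd G x. f v)"
proof -
  have sub: "nbhd G x \<subseteq> pverts G" and nx: "x \<notin> nbhd G x"
    using pair_no_loops[of "(x, x)"] by (auto simp: nbhd_def)
  have finN: "finite (nbhd G x)"
    using sub pair_finite_verts finite_subset by blast
  have "(\<Sum>v\<in>pverts G. f v * lazy_measure G \<epsilon> x v)
      = (\<Sum>v\<in>insert x (nbhd G x). f v * lazy_measure G \<epsilon> x v)"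
    using sub x by (intro sum.mono_neutral_right) (auto simp: lazy_measure_def)
  also have "\<dots> = (1 - \<epsilon>) * f x + (\<Sum>v\<in>nbhd G x. f v * lazy_measure G \<epsilon> x v)"
    using finN nx by (simp add: lazy_measure_def)
  also have "(\<Sum>v\<in>nbhd G x. f v * lazy_measure G \<epsilon> x v) = (\<Sum>v\<in>nbhd G x. \<epsilon> / real d * f v)"
    using nx regular[OF x] by (intro sum.cong) (auto simp: lazy_measure_def)
  finally show ?thesis
    by (simp add: sum_distrib_left)
qed

text \<open>For small \<epsilon> the distance is exactly affine in \<epsilon>, which makes the limit
  defining the curvature immediate. The bound 1/2 ensures that the excess mass \<open>c\<close> at
  \<open>x\<close> is nonnegative, as \<open>\<delta>\<close> is at most \<epsilon>.\<close>

lemma wasserstein_lazy_measure: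
  assumes xy: "(x, y) \<in> parcs G"
    and max: "maximum_matching_between G (excl_nbhd G x y) (excl_nbhd G y x) M"
    and \<epsilon>: "0 < \<epsilon>" "\<epsilon> \<le> 1 / 2"
  shows "wasserstein G (lazy_measure G \<epsilon> x) (lazy_measure G \<epsilon> y)
    = 1 - \<epsilon> * ((real \<alpha> + 2) / real d - (real (card (excl_nbhd G x y)) - real (card M)) / real d)"
proof -
  let ?V = "pverts G" and ?D = "nabla G x y" and ?A = "excl_nbhd G x y" and ?B = "excl_nbhd G y x"
  define \<delta> where "\<delta> = \<epsilon> / real d"
  \<comment> \<open>Each neighbour carries mass \<open>\<delta>\<close>; \<open>c\<close> is what
    remains at the centre once \<open>\<delta>\<close> is set aside there too.\<close>
  define c where "c = 1 - \<epsilon> - \<delta>"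

  \<comment> \<open>Partition and sizes of the two neighbourhoods\<close>
  have V: "x \<in> ?V" "y \<in> ?V"
    using arc_fst_in_verts[OF xy] arc_snd_in_verts[OF xy] by auto
  have yx: "(y, x) \<in> parcs G"
    using xy parcs_sym by blast
  have loop: "(v, v) \<notin> parcs G" for v
    using pair_no_loops by fastforce
  have ne: "x \<noteq> y"
    using xy loop by auto
  have finV: "finite ?V"
    by (rule pair_finite_verts)
  have fin: "finite (nbhd G u)" for u
    using finV by (simp add: nbhd_def)
  have finD: "finite ?D" and finA: "finite ?A" and finB: "finite ?B"
    using fin by (auto simp: nabla_def excl_nbhd_def)
  have nx: "nbhd G x = insert y (?D \<union> ?A)" and ny: "nbhd G y = insert x (?D \<union> ?B)"
    using xy yx by (auto simp: excl_nbhd_def nabla_def nbhd_sym)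
  have notin: "x \<notin> ?D" "y \<notin> ?D" "x \<notin> ?A" "y \<notin> ?A" "x \<notin> ?B" "y \<notin> ?B"
    using loop by (auto simp: excl_nbhd_def nabla_def nbhd_sym)
  have disj: "?D \<inter> ?A = {}" "?D \<inter> ?B = {}" "?A \<inter> ?B = {}"
    by (auto simp: excl_nbhd_def nabla_def)
  have subV: "?D \<subseteq> ?V" "?A \<subseteq> ?V" "?B \<subseteq> ?V"
    by (auto simp: excl_nbhd_def nabla_def nbhd_def)
  have sum_x: "(\<Sum>v\<in>nbhd G x. g v) = g y + (\<Sum>v\<in>?D. g v) + (\<Sum>v\<in>?A. g v)" for g :: "'a \<Rightarrow> real"
    using notin disj finD finA by (simp add: nx sum.union_disjoint)
  have sum_y: "(\<Sum>v\<in>nbhd G y. g v) = g x + (\<Sum>v\<in>?D. g v) + (\<Sum>v\<in>?B. g v)" for g :: "'a \<Rightarrow> real"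
    using notin disj finD finB by (simp add: ny sum.union_disjoint)
  have cD: "card ?D = \<alpha>"
    using adjacent[OF xy] by (simp add: nabla_def)
  have dA: "d = 1 + \<alpha> + card ?A"
    using regular[OF V(1)] notin disj finD finA cD by (simp add: nx card_Un_disjoint)
  have dB: "d = 1 + \<alpha> + card ?B"
    using regular[OF V(2)] notin disj finD finB cD by (simp add: ny card_Un_disjoint)
  have \<delta>: "0 < \<delta>" "\<delta> \<le> \<epsilon>" and d\<delta>: "\<epsilon> = real d * \<delta>"
    using \<epsilon> dA by (auto simp: \<delta>_def field_simps)
  have c: "0 \<le> c"
    using \<epsilon> \<delta> by (simp add: c_def)
  have M: "M \<subseteq> parcs G \<inter> (?A \<times> ?B)" "inj_on fst M" "inj_on snd M"
  proof -
    have M: "matching_between G ?A ?B M"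
      using max by (simp add: maximum_matching_between_def)
    then show "M \<subseteq> parcs G \<inter> (?A \<times> ?B)"
      by (simp add: matching_between_def)
    have "fst e \<noteq> fst f \<and> snd e \<noteq> snd f" if "e \<in> M" "f \<in> M" "e \<noteq> f" for e f
      using M that unfolding matching_between_def by blast
    then show "inj_on fst M" "inj_on snd M"
      unfolding inj_on_def by blast+
  qed
  have finM: "finite M"
    using M(1) finA finB by (meson finite_SigmaI finite_subset le_inf_iff)

  \<comment> \<open>The transport plan\<close>
  define S where "S = insert x (insert y (?D \<union> ?A))"
  obtain \<sigma> where \<sigma>: "bij_betw \<sigma> ?A ?B" "\<And>a b. (a, b) \<in> M \<Longrightarrow> \<sigma> a = b"
    using matching_extends_to_bij[of ?A ?B M] finA finB dA dB M by auto
  define \<tau> where "\<tau> v = (if v \<in> ?A then \<sigma> v else v)" for v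
  let ?T = "insert x (insert y (?D \<union> ?B))"
  have \<tau>: "bij_betw \<tau> S ?T"
  proof -
    have "bij_betw \<tau> (?A \<union> insert x (insert y ?D)) (?B \<union> insert x (insert y ?D))"
    proof (rule bij_betw_combine)
      show "bij_betw \<tau> ?A ?B"
        using \<sigma>(1) by (simp add: \<tau>_def cong: bij_betw_cong)
      have "\<tau> v = v" if "v \<in> insert x (insert y ?D)" for v
        using that notin disj by (auto simp: \<tau>_def)
      then show "bij_betw \<tau> (insert x (insert y ?D)) (insert x (insert y ?D))"
        using bij_betw_cong[of "insert x (insert y ?D)" \<tau> id] by simp
      show "?B \<inter> insert x (insert y ?D) = {}"
        using notin disj by auto
    qed
    then show ?thesis
      by (simp add: S_def Un_commute)
  qed
  have SV: "S \<subseteq> ?V"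
    using V subV by (auto simp: S_def)
  have \<tau>V: "\<tau> v \<in> ?V" if "v \<in> S" for v
    using bij_betwE[OF \<tau>] that V subV by auto
  \<comment> \<open>Apart from the excess \<open>c\<close> at the centre, each measure is uniform of
    weight \<open>\<delta>\<close> on a closed neighbourhood (\<open>S\<close> for \<open>x\<close>,
    \<open>?T\<close> for \<open>y\<close>). The uniform parts are matched along
    \<open>\<tau>\<close>, and the excess goes from \<open>x\<close> to \<open>y\<close>.\<close>
  define \<xi> where "\<xi> = (\<lambda>(v, w). (if v \<in> S \<and> w = \<tau> v then \<delta> else 0) + (if v = x \<and> w = y then c else 0))"
  have lazy_x: "lazy_measure G \<epsilon> x v = (if v \<in> S then \<delta> else 0) + (if v = x then c else 0)" for v
    using notin ne regular[OF V(1)] by (auto simp: lazy_measure_def nx S_def \<delta>_def c_def)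
  have lazy_y: "lazy_measure G \<epsilon> y v = (if v \<in> ?T then \<delta> else 0) + (if v = y then c else 0)" for v
    using notin ne regular[OF V(2)] by (auto simp: lazy_measure_def ny \<delta>_def c_def)
  have plan: "transport_plan ?V (lazy_measure G \<epsilon> x) (lazy_measure G \<epsilon> y) \<xi>"
  proof (rule transport_planI[OF finV])
    show "prob_measure_on ?V (lazy_measure G \<epsilon> x)"
      using V \<epsilon> by (intro prob_measure_on_lazy_measure) (auto simp: nx)
    show "0 \<le> \<xi> (v, w)" for v w
      using \<delta> c by (simp add: \<xi>_def)
    show "(\<Sum>w\<in>?V. \<xi> (v, w)) = lazy_measure G \<epsilon> x v" if "v \<in> ?V" for v
    proof -
      have "(\<Sum>w\<in>?V. if v \<in> S \<and> w = \<tau> v then \<delta> else 0) = (if v \<in> S then \<delta> else 0)"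
        using finV \<tau>V by (cases "v \<in> S") simp_all
      moreover have "(\<Sum>w\<in>?V. if v = x \<and> w = y then c else 0) = (if v = x then c else 0)"
        using finV V by (cases "v = x") simp_all
      ultimately show ?thesis
        by (simp add: \<xi>_def lazy_x sum.distrib)
    qed
    show "(\<Sum>v\<in>?V. \<xi> (v, w)) = lazy_measure G \<epsilon> y w" if "w \<in> ?V" for w
    proof -
      have "(\<Sum>v\<in>?V. if v \<in> S \<and> w = \<tau> v then \<delta> else 0) = (if w \<in> ?T then \<delta> else 0)"
      proof (cases "w \<in> ?T")
        case True
        then obtain u where u: "u \<in> S" "w = \<tau> u"
          using \<tau> by (metis bij_betw_imp_surj_on imageE)
        then have "v \<in> S \<and> w = \<tau> v \<longleftrightarrow> v = u" for v
          using \<tau> by (auto simp: bij_betw_def inj_on_def)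
        then show ?thesis
          using True finV u SV by auto
      next
        case False
        then have "\<not> (v \<in> S \<and> w = \<tau> v)" for v
          using bij_betwE[OF \<tau>] by auto
        then show ?thesis
          using False by (simp only: if_False sum.neutral_const)
      qed
      moreover have "(\<Sum>v\<in>?V. if v = x \<and> w = y then c else 0) = (if w = y then c else 0)"
        using finV V by (cases "w = y") simp_all
      ultimately show ?thesis
        by (simp add: \<xi>_def lazy_y sum.distrib)
    qed
  qed

  \<comment> \<open>Cost of the plan\<close>
  let ?dist = "graph_dist G"
  let ?W = "c + \<delta> * (2 * real (card ?A) - real (card M))"
  have cost: "(\<Sum>v\<in>?V. \<Sum>w\<in>?V. ?dist v w * \<xi> (v, w)) \<le> ?W"
  proof -
    have row: "(\<Sum>w\<in>?V. ?dist v w * \<xi> (v, w))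
        = (if v \<in> S then \<delta> * ?dist v (\<tau> v) else 0) + (if v = x then c else 0)" for v
    proof -
      have "(\<Sum>w\<in>?V. ?dist v w * (if v \<in> S \<and> w = \<tau> v then \<delta> else 0))
          = (if v \<in> S then \<delta> * ?dist v (\<tau> v) else 0)"
        using finV \<tau>V by (cases "v \<in> S") (simp_all add: if_distrib cong: if_cong)
      moreover have "(\<Sum>w\<in>?V. ?dist v w * (if v = x \<and> w = y then c else 0)) = (if v = x then c else 0)"
        using finV V graph_dist_adjacent[OF xy]
        by (cases "v = x") (simp_all add: if_distrib cong: if_cong)
      ultimately show ?thesis
        by (simp add: \<xi>_def sum.distrib distrib_left)
    qed
    have "(\<Sum>v\<in>?V. \<Sum>w\<in>?V. ?dist v w * \<xi> (v, w)) = (\<Sum>v\<in>S. \<delta> * ?dist v (\<tau> v)) + c"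
    proof -
      have "(\<Sum>v\<in>?V. if v \<in> S then \<delta> * ?dist v (\<tau> v) else 0) = (\<Sum>v\<in>S. \<delta> * ?dist v (\<tau> v))"
        using finV SV by (simp add: Int_absorb1 flip: sum.inter_restrict)
      then show ?thesis
        using finV V by (simp add: row sum.distrib)
    qed
    also have "(\<Sum>v\<in>S. \<delta> * ?dist v (\<tau> v)) = (\<Sum>v\<in>?A. \<delta> * ?dist v (\<tau> v))"
    proof (rule sum.mono_neutral_right)
      show "\<forall>v\<in>S - ?A. \<delta> * ?dist v (\<tau> v) = 0"
        using SV by (auto simp: \<tau>_def graph_dist_refl)
    qed (use finD finA in \<open>auto simp: S_def\<close>)
    \<comment> \<open>Two is the largest possible distance; a matched vertex moves along an edge and
      saves one.\<close>
    also have "\<dots> \<le> (\<Sum>v\<in>?A. \<delta> * (2 - (if v \<in> fst ` M then 1 else 0)))"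
    proof (intro sum_mono mult_left_mono)
      fix v assume v: "v \<in> ?A"
      show "?dist v (\<tau> v) \<le> 2 - (if v \<in> fst ` M then 1 else 0)"
      proof (cases "v \<in> fst ` M")
        case True
        then have "(v, \<tau> v) \<in> parcs G"
          using M(1) \<sigma>(2) v by (auto simp: \<tau>_def)
        then show ?thesis
          using True graph_dist_adjacent by simp
      next
        case False
        have "v \<in> ?V" "\<tau> v \<in> ?V"
          using v \<tau>V[of v] subV by (auto simp: S_def)
        then show ?thesis
          using False by (simp add: graph_dist_eq)
      qed
    qed (use \<delta> in auto)
    also have "\<dots> = \<delta> * (2 * real (card ?A) - real (card M))"
    proof -
      have "fst ` M \<subseteq> ?A"
        using M(1) by auto
      then have "(\<Sum>v\<in>?A. if v \<in> fst ` M then 1 else 0) = real (card M)"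
        using finA M(2) by (simp add: Int_absorb1 card_image flip: sum.inter_restrict)
      then show ?thesis
        by (simp add: sum_subtractf flip: sum_distrib_left)
    qed
    finally show ?thesis
      by simp
  qed

  \<comment> \<open>The dual potential from a vertex cover\<close>
  obtain L P Q where L: "L \<subseteq> parcs G \<inter> (?A \<times> ?B)" "inj_on fst L" "inj_on snd L"
    and PQ: "bipartite_cover (parcs G \<inter> (?A \<times> ?B)) P Q" "card P + card Q \<le> card L"
    using koenig[of "parcs G \<inter> (?A \<times> ?B)"] finA finB by auto
  have finPQ: "finite P" "finite Q"
    using PQ(1) by (auto simp: bipartite_cover_def)
  \<comment> \<open>Injectivity separates ends on the same side; disjointness of \<open>N_x\<close>
    and \<open>N_y\<close> rules out a left end equal to a right end. Maximality of \<open>M\<close>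
    then bounds the cover size by \<open>card M\<close>.\<close>
  have "matching_between G ?A ?B L"
    unfolding matching_between_def
  proof (intro conjI ballI impI L)
    fix e f assume ef: "e \<in> L" "f \<in> L" "e \<noteq> f"
    then have "fst e \<noteq> fst f" "snd e \<noteq> snd f"
      using L(2,3) by (auto dest: inj_onD)
    moreover have "fst e \<in> ?A" "snd e \<in> ?B" "fst f \<in> ?A" "snd f \<in> ?B"
      using L(1) ef by auto
    ultimately show "{fst e, snd e} \<inter> {fst f, snd f} = {}"
      using disj(3) by auto
  qed
  then have card_PQ: "card P + card Q \<le> card M"
    using PQ(2) max by (auto simp: maximum_matching_between_def)
  define f :: "'a \<Rightarrow> real" where
    "f v = (if v \<in> ?A - P then 2 else if v \<in> insert y (?B - Q) then 0 else 1)" for v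
  \<comment> \<open>The Lipschitz bound could fail only at adjacent vertices with values 2 and 0.
    Such a pair would join \<open>N_x\<close> to \<open>y\<close>, against the definition of
    \<open>N_x\<close>, or be an edge that the cover misses.\<close>
  have apart: "(u, v) \<notin> parcs G" if "u \<in> ?A - P" "v \<in> insert y (?B - Q)" for u v
  proof (cases "v = y")
    case True
    then show ?thesis
      using that parcs_sym[of u y] by (auto simp: excl_nbhd_def nabla_def nbhd_sym)
  next
    case False
    then show ?thesis
      using that PQ(1) by (auto simp: bipartite_cover_def)
  qed
  have Lipschitz: "f u - f v \<le> ?dist u v" if "u \<in> ?V" "v \<in> ?V" for u v
    using apart[of u v] by (auto simp: graph_dist_eq[OF that] f_def)
  have f_xy: "f x = 1" "f y = 0"
    using notin ne by (auto simp: f_def)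
  have f_D: "(\<Sum>v\<in>?D. f v) = real \<alpha>"
  proof -
    have "(\<Sum>v\<in>?D. f v) = (\<Sum>v\<in>?D. 1)"
      using notin disj by (intro sum.cong) (auto simp: f_def)
    then show ?thesis
      by (simp add: cD)
  qed
  \<comment> \<open>Only an inequality, because \<open>P\<close> may contain vertices outside
    \<open>N_x\<close>; likewise for \<open>Q\<close> below.\<close>
  have f_A: "2 * real (card ?A) - real (card P) \<le> (\<Sum>v\<in>?A. f v)"
  proof -
    have "(\<Sum>v\<in>?A. f v) = (\<Sum>v\<in>?A. 2 - (if v \<in> P then 1 else 0))"
      using notin disj by (intro sum.cong) (auto simp: f_def)
    also have "\<dots> = 2 * real (card ?A) - real (card (?A \<inter> P))"
      using finA by (simp add: sum_subtractf flip: sum.inter_restrict)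
    finally show ?thesis
      using card_mono[OF finPQ(1), of "?A \<inter> P"] by simp
  qed
  have f_B: "(\<Sum>v\<in>?B. f v) \<le> real (card Q)"
  proof -
    have "(\<Sum>v\<in>?B. f v) = (\<Sum>v\<in>?B. if v \<in> Q then 1 else 0)"
      using notin disj by (intro sum.cong) (auto simp: f_def)
    also have "\<dots> = real (card (?B \<inter> Q))"
      using finB by (simp flip: sum.inter_restrict)
    finally show ?thesis
      using card_mono[OF finPQ(2), of "?B \<inter> Q"] by simp
  qed
  have "2 * real (card ?A) - real (card M) \<le> (\<Sum>v\<in>?A. f v) - (\<Sum>v\<in>?B. f v)"
    using f_A f_B card_PQ by linarith
  then have "\<delta> * (2 * real (card ?A) - real (card M)) \<le> \<delta> * ((\<Sum>v\<in>?A. f v) - (\<Sum>v\<in>?B. f v))"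
    using \<delta> by (intro mult_left_mono) auto
  \<comment> \<open>The common neighbours cancel. The centres contribute
    \<open>1 - \<epsilon>\<close> and their appearance as each other's neighbour contributes
    \<open>- \<delta>\<close>, together \<open>c\<close>.\<close>
  then have dual: "?W \<le> (\<Sum>v\<in>?V. f v * lazy_measure G \<epsilon> x v) - (\<Sum>v\<in>?V. f v * lazy_measure G \<epsilon> y v)"
    unfolding sum_lazy_measure[OF V(1)] sum_lazy_measure[OF V(2)] sum_x sum_y f_xy f_D
      \<delta>_def[symmetric]
    by (simp add: c_def algebra_simps)
  have "wasserstein G (lazy_measure G \<epsilon> x) (lazy_measure G \<epsilon> y) = ?W"
    by (rule wasserstein_eqI[OF _ plan cost Lipschitz dual]) (simp add: graph_dist_eq)
  also have "\<dots> = 1 - \<epsilon> * ((real \<alpha> + 2) / real d - (real (card ?A) - real (card M)) / real d)"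
  \<comment> \<open>The degree count \<open>d = 1 + \<alpha> + card ?A\<close> turns \<epsilon> into
    a multiple of \<open>\<delta>\<close>, after which both sides agree as polynomials.\<close>
  proof -
    have "\<epsilon> * ((real \<alpha> + 2) / real d - (real (card ?A) - real (card M)) / real d)
        = \<delta> * (real \<alpha> + 2 - real (card ?A) + real (card M))"
      by (simp add: \<delta>_def diff_divide_distrib add_divide_distrib algebra_simps)
    moreover have "\<epsilon> = \<delta> * (1 + real \<alpha> + real (card ?A))"
      using d\<delta> dA by (simp add: mult.commute)
    ultimately show ?thesis
      by (simp add: c_def algebra_simps)
  qed
  finally show ?thesis .
qed

end

theorem theorem1p2:
  fixes G :: "'a pair_pre_digraph" and n d \<alpha> \<beta> m :: nat and x y :: 'a
    and \<M> :: "('a \<times> 'a) set"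
  assumes "strongly_regular_graph G n d \<alpha> \<beta>"
    and "(x, y) \<in> parcs G"
    and "maximum_matching_between G (excl_nbhd G x y) (excl_nbhd G y x) \<M>"
    and "card \<M> = m"
  shows "condensed_ricci_curvature G x y =
    (real \<alpha> + 2) / real d - (real (card (excl_nbhd G x y)) - real m) / real d"
proof -
  interpret strongly_regular_graph G n d \<alpha> \<beta>
    by (rule assms(1))
  let ?k = "(real \<alpha> + 2) / real d - (real (card (excl_nbhd G x y)) - real m) / real d"
  have "ollivier_curvature G \<epsilon> x y / \<epsilon> = ?k" if "0 < \<epsilon>" "\<epsilon> \<le> 1 / 2" for \<epsilon>
    using wasserstein_lazy_measure[OF assms(2,3) that] that graph_dist_adjacent[OF assms(2)] assms(4)
    by (simp add: ollivier_curvature_def)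
  \<comment> \<open>The quotient is constant on the interval from 0 to 1/2, so its limit at 0 is
    that constant.\<close>
  then have "\<forall>\<^sub>F \<epsilon> in at_right 0. ollivier_curvature G \<epsilon> x y / \<epsilon> = ?k"
    by (auto simp: eventually_at_right_field intro!: exI[of _ "1 / 2"])
  then have "((\<lambda>\<epsilon>. ollivier_curvature G \<epsilon> x y / \<epsilon>) \<longlongrightarrow> ?k) (at_right 0)"
    by (rule tendsto_eventually)
  then show ?thesis
    unfolding condensed_ricci_curvature_def by (intro tendsto_Lim) auto
qed

end
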